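(* Let $P$ be a $d$-dimensional real reflexive polytope such that every root $z\in\mathbb{C}$ of $L_P$ satisfies $-1<\operatorname{Re}(z)<0$. Then $\operatorname{vol}(P)\geq 2^d$.
   Context: A $d$-dimensional lattice polytope is a full-dimensional convex polytope $P\subset\mathbb{Z}^d\otimes_{\mathbb{Z}}\mathbb{Q}$ with vertices in $\mathbb{Z}^d$. It is reflexive if its dual $P^*:=\{u\in\mathbb{Z}^d\otimes_{\mathbb{Z}}\mathbb{Q}\mid\langle u,v\rangle\geq -1\text{ for all }v\in P\}$ is also a lattice polytope. $\operatorname{vol}(P)$ denotes the usual (non-normalised) Euclidean volume. The Ehrhart polynomial $L_P$ is the degree-$d$ polynomial with $L_P(m)=|mP\cap\mathbb{Z}^d|$ for all integers $m\geq 0$, regarded as a polynomial over $\mathbb{C}$. $P$ is real if every root $z\in\mathbb{C}$ of $L_P$ satisfies $\operatorname{Im}(z)=0$. *)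

theory Defs
  imports "HOL-Analysis.Analysis" "HOL-Computational_Algebra.Polynomial"
begin

definition int_lattice :: "(real ^ 'n) set" where
  "int_lattice = {x. \<forall>i. x $ i \<in> \<int>}"

text \<open>The ambient space is the real vector space rather than the rational one; a polytope with
  lattice vertices is the convex hull of finitely many lattice points over either field.\<close>

definition lattice_polytope :: "(real ^ 'n) set \<Rightarrow> bool" where
  "lattice_polytope P \<longleftrightarrow>
     polytope P \<and> aff_dim P = int CARD('n) \<and> {v. v extreme_point_of P} \<subseteq> int_lattice"

definition dual_polytope :: "(real ^ 'n) set \<Rightarrow> (real ^ 'n) set" where
  "dual_polytope P = {u. \<forall>v\<in>P. u \<bullet> v \<ge> -1}"

text \<open>No separate condition on the origin is needed: if \<open>0\<close> is not an interior point of \<open>P\<close>, then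
  the dual is unbounded, hence not a polytope.\<close>

definition reflexive_polytope :: "(real ^ 'n) set \<Rightarrow> bool" where
  "reflexive_polytope P \<longleftrightarrow> lattice_polytope P \<and> lattice_polytope (dual_polytope P)"

text \<open>For a lattice polytope the description below determines a unique polynomial, by Ehrhart's
  theorem.\<close>

definition ehrhart_poly :: "(real ^ 'n) set \<Rightarrow> complex poly" where
  "ehrhart_poly P =
     (THE L. degree L = CARD('n) \<and>
        (\<forall>m::nat. poly L (of_nat m) = of_nat (card ((\<lambda>x. real m *\<^sub>R x) ` P \<inter> int_lattice))))"

definition real_polytope :: "(real ^ 'n) set \<Rightarrow> bool" where
  "real_polytope P \<longleftrightarrow> (\<forall>z. poly (ehrhart_poly P) z = 0 \<longrightarrow> Im z = 0)"

end

theory Submission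
  imports Defs "HOL-Computational_Algebra.Fundamental_Theorem_Algebra"
begin

text \<open>Let \<open>L\<close> be the Ehrhart polynomial, \<open>a\<close> its leading coefficient and \<open>d\<close> its degree. Both
  \<open>L(0)\<close> and \<open>L(-1)\<close> are integers, and they are non-zero because all roots lie strictly between
  \<open>-1\<close> and \<open>0\<close>. Hence \<open>1 \<le> \<bar>L(0) L(-1)\<bar> = a\<^sup>2 \<Prod> \<bar>z\<bar> \<bar>1 + z\<bar> \<le> a\<^sup>2 / 4 ^ d\<close>, the product being
  over the roots \<open>z\<close>, and \<open>a \<le> vol P\<close> by comparing lattice points with unit cubes.

  Ehrhart's theorem itself is obtained by cutting the cone over \<open>P \<times> {1}\<close> into half-open simplicial
  cones: the lattice points of such a cone are uniquely a lattice point of a half-open box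
  plus a natural combination of the generators.\<close>

section \<open>Triangulating a finitely generated cone\<close>

text \<open>The obstacle is that a single polynomial has to count correctly at every natural m,
  including 0. If a box contained the sum of all its generators, that point would have height d + 1
  and its binomial would be (-1)^d at m = 0 instead of 0. A generic direction \<open>q\<close>
  inside the cone decides which facets each simplicial cone keeps. It has positive height, so some
  coordinate of \<open>q\<close> is positive in every cell, and box points have height at most d. At
  -1 a binomial of such a height is 0 or (-1)^d, so the integrality of L(-1) falls out of the count
  without reciprocity. Genericity also discards the lower-dimensional cells: all binomials then have
  degree d and leading coefficient 1/d!, so nothing cancels and the degree is exactly d.\<close>

definition open_cone :: "'a::real_vector set \<Rightarrow> 'a set" where
  "open_cone S = {\<Sum>v\<in>S. c v *\<^sub>R v | c. \<forall>v\<in>S. (0::real) < c v}"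

lemma open_coneI: "(\<And>v. v \<in> S \<Longrightarrow> (0::real) < c v) \<Longrightarrow> (\<Sum>v\<in>S. c v *\<^sub>R v) \<in> open_cone S"
  unfolding open_cone_def by blast

lemma open_cone_empty [simp]: "open_cone {} = {0}"
  by (auto simp: open_cone_def)

lemma open_cone_subset_span: "open_cone S \<subseteq> span S"
  unfolding open_cone_def by (clarify, intro span_sum span_scale span_base)

lemma convex_cone_hull_sum:
  assumes "\<And>v. v \<in> S \<Longrightarrow> v \<in> convex_cone hull G" "\<And>v. v \<in> S \<Longrightarrow> 0 \<le> c v"
  shows "(\<Sum>v\<in>S. c v *\<^sub>R v) \<in> convex_cone hull G"
  using assms
  by (induction S rule: infinite_finite_induct)
     (auto intro!: convex_cone_hull_add convex_cone_hull_mul convex_cone_hull_contains_0)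

lemma open_cone_subset_hull:
  assumes "S \<subseteq> G"
  shows "open_cone S \<subseteq> convex_cone hull G"
  using assms unfolding open_cone_def
  by (clarify, intro convex_cone_hull_sum) (auto simp: hull_inc subset_iff less_imp_le)

lemma open_cone_scale:
  assumes "x \<in> open_cone S" "0 < t"
  shows "t *\<^sub>R x \<in> open_cone S"
proof -
  obtain c where c: "\<forall>v\<in>S. (0::real) < c v" "x = (\<Sum>v\<in>S. c v *\<^sub>R v)"
    using assms(1) unfolding open_cone_def by blast
  have "t *\<^sub>R x = (\<Sum>v\<in>S. (t * c v) *\<^sub>R v)"
    by (simp add: c(2) scaleR_sum_right)
  then show ?thesis
    using c(1) assms(2) by (auto intro!: open_coneI)
qed

lemma open_cone_add:
  assumes "x \<in> open_cone S" "y \<in> open_cone S"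
  shows "x + y \<in> open_cone S"
proof -
  obtain c where c: "\<forall>v\<in>S. (0::real) < c v" "x = (\<Sum>v\<in>S. c v *\<^sub>R v)"
    using assms(1) unfolding open_cone_def by blast
  obtain d where d: "\<forall>v\<in>S. (0::real) < d v" "y = (\<Sum>v\<in>S. d v *\<^sub>R v)"
    using assms(2) unfolding open_cone_def by blast
  have "x + y = (\<Sum>v\<in>S. (c v + d v) *\<^sub>R v)"
    by (simp add: c(2) d(2) scaleR_left_distrib sum.distrib)
  then show ?thesis
    using c(1) d(1) by (auto intro!: open_coneI add_pos_pos)
qed

text \<open>Strictly positive coefficients tolerate a small change along any vector of the span, and
  finiteness of \<open>S\<close> gives one threshold for all coefficients.\<close>

lemma open_cone_perturb:
  assumes "finite S" "x \<in> open_cone S" "z \<in> span S"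
  obtains \<delta> where "0 < \<delta>" "\<And>\<epsilon>. 0 \<le> \<epsilon> \<Longrightarrow> \<epsilon> \<le> \<delta> \<Longrightarrow> x + \<epsilon> *\<^sub>R z \<in> open_cone S"
proof -
  obtain c where c: "\<forall>v\<in>S. (0::real) < c v" "x = (\<Sum>v\<in>S. c v *\<^sub>R v)"
    using assms(2) unfolding open_cone_def by blast
  obtain d where d: "z = (\<Sum>v\<in>S. d v *\<^sub>R v)"
    using assms(3) span_finite[OF assms(1)] by auto
  have "\<forall>v\<in>S. \<exists>\<delta>>0. \<forall>\<epsilon>. 0 \<le> \<epsilon> \<and> \<epsilon> \<le> \<delta> \<longrightarrow> 0 < c v + \<epsilon> * d v"
  proof
    fix v assume "v \<in> S"
    then have cv: "0 < c v" using c by blast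
    show "\<exists>\<delta>>0. \<forall>\<epsilon>. 0 \<le> \<epsilon> \<and> \<epsilon> \<le> \<delta> \<longrightarrow> 0 < c v + \<epsilon> * d v"
    \<comment> \<open>The summand 1 avoids division by zero and leaves a slack of \<epsilon>, which
      keeps the inequality strict.\<close>
    proof (intro exI[of _ "c v / (\<bar>d v\<bar> + 1)"] conjI allI impI)
      show "0 < c v / (\<bar>d v\<bar> + 1)" using cv by simp
      fix \<epsilon> :: real assume e: "0 \<le> \<epsilon> \<and> \<epsilon> \<le> c v / (\<bar>d v\<bar> + 1)"
      then have "\<epsilon> * (\<bar>d v\<bar> + 1) \<le> c v" by (simp add: field_simps)
      moreover have "- (\<epsilon> * \<bar>d v\<bar>) \<le> \<epsilon> * d v"
        using e mult_left_mono[of "- \<bar>d v\<bar>" "d v" \<epsilon>] by simp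
      ultimately show "0 < c v + \<epsilon> * d v"
        using e cv by (cases "\<epsilon> = 0") (auto simp: algebra_simps)
    qed
  qed
  then obtain \<delta>' where \<delta>': "\<And>v. v \<in> S \<Longrightarrow> 0 < \<delta>' v"
      "\<And>v \<epsilon>. v \<in> S \<Longrightarrow> 0 \<le> \<epsilon> \<Longrightarrow> \<epsilon> \<le> \<delta>' v \<Longrightarrow> 0 < c v + \<epsilon> * d v"
    by metis
  \<comment> \<open>Inserting 1 keeps the minimum meaningful when \<open>S\<close> is empty.\<close>
  define \<delta> where "\<delta> = Min (insert 1 (\<delta>' ` S))"
  have fin: "finite (insert 1 (\<delta>' ` S))" using assms(1) by simp
  show thesis
  proof
    show "0 < \<delta>" unfolding \<delta>_def using fin \<delta>'(1) by (subst Min_gr_iff) auto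
    fix \<epsilon> :: real assume e: "0 \<le> \<epsilon>" "\<epsilon> \<le> \<delta>"
    have "\<epsilon> \<le> \<delta>' v" if "v \<in> S" for v
      using e(2) that fin unfolding \<delta>_def by (meson Min_le image_eqI insertI2 order_trans)
    then have "(\<Sum>v\<in>S. (c v + \<epsilon> * d v) *\<^sub>R v) \<in> open_cone S"
      using \<delta>'(2) e(1) by (auto intro!: open_coneI)
    also have "(\<Sum>v\<in>S. (c v + \<epsilon> * d v) *\<^sub>R v) = x + \<epsilon> *\<^sub>R z"
      by (simp add: c(2) d scaleR_left_distrib sum.distrib scaleR_sum_right)
    finally show "x + \<epsilon> *\<^sub>R z \<in> open_cone S" .
  qed
qed

lemma open_cone_insert:
  assumes "finite S" "g \<notin> S"
  shows "x \<in> open_cone (insert g S) \<longleftrightarrow> (\<exists>c>0. \<exists>y\<in>open_cone S. x = y + c *\<^sub>R g)"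
proof
  assume "x \<in> open_cone (insert g S)"
  then obtain c where c: "\<forall>v\<in>insert g S. (0::real) < c v" "x = (\<Sum>v\<in>insert g S. c v *\<^sub>R v)"
    unfolding open_cone_def by blast
  then have "x = (\<Sum>v\<in>S. c v *\<^sub>R v) + c g *\<^sub>R g"
    using assms by (simp add: add.commute)
  then show "\<exists>c>0. \<exists>y\<in>open_cone S. x = y + c *\<^sub>R g"
    using c(1) by (auto intro!: exI[of _ "c g"] bexI[of _ "\<Sum>v\<in>S. c v *\<^sub>R v"] open_coneI)
next
  assume "\<exists>c>0. \<exists>y\<in>open_cone S. x = y + c *\<^sub>R g"
  then obtain a c where a: "a > 0" and c: "\<forall>v\<in>S. (0::real) < c v"
    and x: "x = (\<Sum>v\<in>S. c v *\<^sub>R v) + a *\<^sub>R g"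
    unfolding open_cone_def by blast
  have "(\<Sum>v\<in>S. c v *\<^sub>R v) = (\<Sum>v\<in>S. (c(g := a)) v *\<^sub>R v)"
    using assms(2) by (intro sum.cong) auto
  then have "x = (\<Sum>v\<in>insert g S. (c(g := a)) v *\<^sub>R v)"
    using assms x by (simp add: add.commute)
  then show "x \<in> open_cone (insert g S)"
    by (simp only:) (rule open_coneI, use a c in auto)
qed

lemma convex_cone_hull_insert_iff:
  "x \<in> convex_cone hull (insert g G) \<longleftrightarrow>
     (\<exists>c\<ge>0. \<exists>y\<in>convex_cone hull G. x = y + c *\<^sub>R g)"
proof -
  have g: "y \<in> convex_cone hull {g} \<longleftrightarrow> (\<exists>c\<ge>0. y = c *\<^sub>R g)" for y
    by (subst convex_cone_hull_convex_hull_nonempty) auto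
  have "x \<in> convex_cone hull (insert g G)
      \<longleftrightarrow> (\<exists>y\<in>convex_cone hull G. \<exists>z\<in>convex_cone hull {g}. x = y + z)"
    using convex_cone_hull_Un[of G "{g}"] by simp
  then show ?thesis
    unfolding Bex_def g by metis
qed

text \<open>The construction is the placing triangulation: \<open>y\<close> is visible from \<open>g\<close> when moving
  towards \<open>g\<close> leaves the old cone at once, and every new point has a unique expression
  \<open>y + c *\<^sub>R g\<close> with \<open>y\<close> visible, namely the one with the least \<open>c\<close>.\<close>

lemma cone_triangulation:
  fixes G :: "'a::euclidean_space set"
  assumes "finite G"
  obtains D where "D \<subseteq> Pow G" "\<And>S. S \<in> D \<Longrightarrow> independent S"
    "disjoint_family_on open_cone D" "(\<Union>S\<in>D. open_cone S) = convex_cone hull G"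
proof -
  have "\<exists>D. D \<subseteq> Pow G \<and> (\<forall>S\<in>D. independent S) \<and> disjoint_family_on open_cone D
      \<and> (\<Union>S\<in>D. open_cone S) = convex_cone hull G"
    using assms
  proof (induction G rule: finite_induct)
    case empty
    \<comment> \<open>The cone {0} has the single cell \<open>{}\<close>. Cells of all dimensions
      are kept at this stage.\<close>
    show ?case by (rule exI[of _ "{{}}"]) (auto simp: independent_empty disjoint_family_on_def)
  next
    case (insert g G)
    let ?C = "convex_cone hull G"
    obtain D where D: "D \<subseteq> Pow G" "\<And>S. S \<in> D \<Longrightarrow> independent S" "disjoint_family_on open_cone D"
        "(\<Union>S\<in>D. open_cone S) = ?C"
      using insert.IH by (elim exE conjE) (rule that, auto)
    define vis where "vis y \<longleftrightarrow> (\<forall>\<epsilon>>0. y + \<epsilon> *\<^sub>R g \<notin> ?C)" for y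
    have fin: "finite S" if "S \<in> D" for S
      using that D(1) insert.hyps(1) finite_subset by blast
    \<comment> \<open>Visibility belongs to the whole cell: \<open>y\<close> can give up a small
      multiple of \<open>y'\<close> without leaving it, and putting that multiple back together with
      a step towards \<open>g\<close> moves \<open>y\<close> towards \<open>g\<close> inside the
      cone.\<close>
    have vis_const: "vis y'" if S: "S \<in> D" "y \<in> open_cone S" "y' \<in> open_cone S" "vis y" for S y y'
    proof (rule ccontr)
      assume "\<not> vis y'"
      then obtain \<epsilon> where e: "\<epsilon> > 0" "y' + \<epsilon> *\<^sub>R g \<in> ?C" unfolding vis_def by blast
      have "- y' \<in> span S"
        using S(3) by (auto intro: span_neg subsetD[OF open_cone_subset_span])
      from open_cone_perturb[OF fin[OF S(1)] S(2) this]
      obtain \<delta> where d: "0 < \<delta>" "y + \<delta> *\<^sub>R (- y') \<in> open_cone S"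
        by (metis order_refl less_imp_le)
      have "y + \<delta> *\<^sub>R (- y') \<in> ?C" using d(2) D(4) S(1) by blast
      moreover have "\<delta> *\<^sub>R (y' + \<epsilon> *\<^sub>R g) \<in> ?C"
        using e(2) d(1) by (auto intro: convex_cone_hull_mul)
      ultimately have "(y + \<delta> *\<^sub>R (- y')) + \<delta> *\<^sub>R (y' + \<epsilon> *\<^sub>R g) \<in> ?C"
        by (rule convex_cone_hull_add)
      then have "y + (\<delta> * \<epsilon>) *\<^sub>R g \<in> ?C" by (simp add: algebra_simps)
      then show False using S(4) d(1) e(1) unfolding vis_def by simp
    qed
    \<comment> \<open>Otherwise a short step towards \<open>g\<close> would stay in the cell. This
      is what makes \<open>insert g S\<close> independent.\<close>
    have vis_span: "g \<notin> span S" if S: "S \<in> D" "y \<in> open_cone S" "vis y" for S y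
    proof
      assume "g \<in> span S"
      from open_cone_perturb[OF fin[OF S(1)] S(2) this]
      obtain \<delta> where "0 < \<delta>" "y + \<delta> *\<^sub>R g \<in> open_cone S"
        by (metis order_refl less_imp_le)
      then show False using S(1,3) D(4) unfolding vis_def by blast
    qed
    \<comment> \<open>Both points lie on one line in direction \<open>g\<close>; the one with the
      larger coefficient would reach the other by moving towards \<open>g\<close>, contradicting its
      visibility.\<close>
    have vis_unique: "y = y' \<and> c = c'"
      if "y \<in> ?C" "y' \<in> ?C" "vis y" "vis y'" and eq: "y + c *\<^sub>R g = y' + c' *\<^sub>R g" for y y' c c'
    proof -
      have "y = y' + (c' - c) *\<^sub>R g" "y' = y + (c - c') *\<^sub>R g"
        using eq by (simp_all add: algebra_simps)
      then have "\<not> c < c'" "\<not> c' < c"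
        using that unfolding vis_def by (metis diff_gt_0_iff_gt)+
      then show ?thesis using eq by simp
    qed
    define V where "V = {S \<in> D. \<exists>y\<in>open_cone S. vis y}"
    have V: "vis y" if "S \<in> V" "y \<in> open_cone S" for S y
      using that vis_const unfolding V_def by blast
    have gS: "g \<notin> S" if "S \<in> D" for S using that D(1) insert.hyps(2) by blast
    let ?D = "D \<union> insert g ` V"
    have new: "x \<in> open_cone (insert g S) \<longleftrightarrow> (\<exists>c>0. \<exists>y\<in>open_cone S. x = y + c *\<^sub>R g)"
      if "S \<in> V" for x S
      using that open_cone_insert[OF fin gS] unfolding V_def by blast
    have VC: "open_cone S \<subseteq> ?C" if "S \<in> V" for S using that D(4) unfolding V_def by blast
    have old_new: "open_cone (insert g S) \<inter> ?C = {}" if "S \<in> V" for S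
    proof -
      have False if "z \<in> open_cone (insert g S)" "z \<in> ?C" for z
        using that new[OF \<open>S \<in> V\<close>] V[OF \<open>S \<in> V\<close>] unfolding vis_def by metis
      then show ?thesis by blast
    qed
    have disj: "open_cone S \<inter> open_cone T = {}" if "S \<in> ?D" "T \<in> ?D" "S \<noteq> T" for S T
    proof -
      have oo: "open_cone S \<inter> open_cone T = {}" if "S \<in> D" "T \<in> D" "S \<noteq> T" for S T
        using D(3) that unfolding disjoint_family_on_def by blast
      have on: "open_cone S \<inter> open_cone (insert g T) = {}" if "S \<in> D" "T \<in> V" for S T
        using old_new[OF that(2)] D(4) that(1) by blast
      have nn: "open_cone (insert g S) \<inter> open_cone (insert g T) = {}"
        if "S \<in> V" "T \<in> V" "S \<noteq> T" for S T
      proof -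
        have "open_cone S \<inter> open_cone T = {}" using oo that unfolding V_def by blast
        moreover have False
          if z: "z \<in> open_cone (insert g S)" "z \<in> open_cone (insert g T)" for z
        proof -
          obtain c y where y: "y \<in> open_cone S" "z = y + c *\<^sub>R g"
            using z(1) new[OF \<open>S \<in> V\<close>] by metis
          obtain c' y' where y': "y' \<in> open_cone T" "z = y' + c' *\<^sub>R g"
            using z(2) new[OF \<open>T \<in> V\<close>] by metis
          have "y = y'"
            using vis_unique[of y y' c c'] y y' V VC \<open>S \<in> V\<close> \<open>T \<in> V\<close> by (metis subsetD)
          then show False using y(1) y'(1) calculation by blast
        qed
        ultimately show ?thesis by blast
      qed
      from that show ?thesis
        by (elim UnE imageE; metis oo on nn Int_commute)
    qed
    have cover: "(\<Union>S\<in>?D. open_cone S) = convex_cone hull (insert g G)"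
    proof (intro equalityI subsetI)
      fix x assume "x \<in> (\<Union>S\<in>?D. open_cone S)"
      then obtain S where "S \<in> ?D" "x \<in> open_cone S" by blast
      moreover have "S \<subseteq> insert g G" using calculation(1) D(1) unfolding V_def by blast
      ultimately show "x \<in> convex_cone hull (insert g G)" using open_cone_subset_hull by blast
    next
      fix x assume "x \<in> convex_cone hull (insert g G)"
      then obtain c0 y0 where c0: "c0 \<ge> 0" "y0 \<in> ?C" "x = y0 + c0 *\<^sub>R g"
        using convex_cone_hull_insert_iff by metis
      \<comment> \<open>Slide \<open>x\<close> back along \<open>g\<close> as far as the old cone
        allows. A finitely generated cone is closed, so the least coefficient is attained.\<close>
      define K where "K = {c. 0 \<le> c \<and> x - c *\<^sub>R g \<in> ?C}"
      have "closed ?C" using insert.hyps(1) closed_convex_cone_hull by blast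
      then have "closed ((\<lambda>c. x - c *\<^sub>R g) -` ?C \<inter> {0..})"
        by (intro closed_vimage closed_Int continuous_intros) auto
      moreover have "(\<lambda>c. x - c *\<^sub>R g) -` ?C \<inter> {0..} = K" unfolding K_def by auto
      ultimately have "closed K" by simp
      moreover have "c0 \<in> K" unfolding K_def using c0 by simp
      moreover have bdd: "bdd_below K" unfolding K_def by (rule bdd_belowI[of _ 0]) auto
      ultimately have c: "Inf K \<in> K" using closed_contains_Inf by blast
      define c where "c = Inf K"
      define y where "y = x - c *\<^sub>R g"
      have y: "y \<in> ?C" "c \<ge> 0" using c unfolding y_def c_def K_def by auto
      show "x \<in> (\<Union>S\<in>?D. open_cone S)"
      proof (cases "c = 0")
        case True
        then show ?thesis using y D(4) unfolding y_def by auto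
      next
        case False
        then have cpos: "c > 0" using y(2) by simp
        have "vis y" unfolding vis_def
        proof (intro allI impI notI)
          fix \<epsilon> :: real assume e: "\<epsilon> > 0" "y + \<epsilon> *\<^sub>R g \<in> ?C"
          \<comment> \<open>Capping the step at \<open>c\<close> keeps the new coefficient
            \<open>c - t * \<epsilon>\<close> nonnegative, hence in \<open>K\<close> and below the
            minimum.\<close>
          define t where "t = min \<epsilon> c / \<epsilon>"
          have t: "0 < t" "t \<le> 1" "t * \<epsilon> \<le> c" using e cpos by (auto simp: t_def)
          have "(1 - t) *\<^sub>R y + t *\<^sub>R (y + \<epsilon> *\<^sub>R g) \<in> ?C"
            by (rule convexD[OF convex_convex_cone_hull y(1) e(2)]) (use t in auto)
          then have "x - (c - t * \<epsilon>) *\<^sub>R g \<in> ?C" by (simp add: y_def algebra_simps)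
          then have "c - t * \<epsilon> \<in> K" using t unfolding K_def by simp
          then have "c \<le> c - t * \<epsilon>" using bdd unfolding c_def by (rule cInf_lower)
          moreover have "0 < t * \<epsilon>" using t(1) e(1) by simp
          ultimately show False by simp
        qed
        obtain S where S: "S \<in> D" "y \<in> open_cone S" using y(1) D(4) by blast
        then have "S \<in> V" unfolding V_def using \<open>vis y\<close> by blast
        moreover have "x = y + c *\<^sub>R g" by (simp add: y_def)
        ultimately have "x \<in> open_cone (insert g S)" using S(2) new cpos by blast
        then show ?thesis using \<open>S \<in> V\<close> by blast
      qed
    qed
    have "independent (insert g S)" if "S \<in> V" for S
    proof (rule independent_insertI)
      show "g \<notin> span S" "independent S" using that D(2) vis_span unfolding V_def by blast+
    qed
    then have "independent S" if "S \<in> ?D" for S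
      using that D(2) by blast
    moreover have "?D \<subseteq> Pow (insert g G)" using D(1) unfolding V_def by blast
    moreover have "disjoint_family_on open_cone ?D"
      unfolding disjoint_family_on_def using disj by simp
    ultimately show ?case
      using cover by (intro exI[of _ ?D] conjI ballI)
  qed
  then show thesis using that by metis
qed

section \<open>Half-open decompositions\<close>

lemma convex_open_cone: "convex (open_cone S)"
proof (rule convexI)
  fix x y and u v :: real
  assume "x \<in> open_cone S" "y \<in> open_cone S" "0 \<le> u" "0 \<le> v" "u + v = 1"
  then show "u *\<^sub>R x + v *\<^sub>R y \<in> open_cone S"
    by (cases "u = 0"; cases "v = 0") (auto intro!: open_cone_add open_cone_scale)
qed

text \<open>The proper subspaces spanned by subsets of \<open>G\<close> are finitely many null sets,
  so they cannot cover a nonempty open set.\<close>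

lemma generic_vector:
  fixes C :: "'a::euclidean_space set"
  assumes "finite G" "interior C \<noteq> {}"
  obtains q where "q \<in> C" "\<And>S. S \<subseteq> G \<Longrightarrow> q \<in> span S \<Longrightarrow> span S = UNIV"
proof -
  have "negligible (\<Union>(span ` {S \<in> Pow G. span S \<noteq> UNIV}))"
    using assms(1)
    by (intro negligible_Union)
       (auto intro!: negligible_lowdim simp: order_less_le dim_subset_UNIV dim_eq_full)
  then have "\<not> interior C \<subseteq> \<Union>(span ` {S \<in> Pow G. span S \<noteq> UNIV})"
    using open_not_negligible[OF open_interior assms(2)] negligible_subset by blast
  then obtain q where q: "q \<in> interior C" "q \<notin> \<Union>(span ` {S \<in> Pow G. span S \<noteq> UNIV})"
    by blast
  show thesis
  proof (rule that[of q])
    show "q \<in> C" using q(1) interior_subset by blast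
    show "span S = UNIV" if "S \<subseteq> G" "q \<in> span S" for S using q(2) that by blast
  qed
qed

text \<open>Positivity under an infinitesimal perturbation is lexicographic positivity of the pair
  (a, b). Applied to each coordinate of \<open>x + \<epsilon> *\<^sub>R q\<close>, it replaces a
  limit by a sign test.\<close>

lemma eventually_at_right_affine_pos_iff:
  fixes a b :: real
  shows "(\<forall>\<^sub>F \<epsilon> in at_right 0. 0 < a + \<epsilon> * b) \<longleftrightarrow> 0 < a \<or> a = 0 \<and> 0 < b"
proof -
  have lim: "((\<lambda>\<epsilon>. a + \<epsilon> * b) \<longlongrightarrow> a) (at_right 0)"
    by (auto intro!: tendsto_eq_intros)
  have pos: "\<forall>\<^sub>F \<epsilon> in at_right 0. (0::real) < \<epsilon>"
    by (rule eventually_at_right_less)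
  consider "0 < a" | "a < 0" | "a = 0" by linarith
  then show ?thesis
  proof cases
    case 1
    then show ?thesis using order_tendstoD(1)[OF lim] by simp
  next
    case 2
    have "\<not> (\<forall>\<^sub>F \<epsilon> in at_right 0. 0 < a + \<epsilon> * b)"
    proof
      assume "\<forall>\<^sub>F \<epsilon> in at_right 0. 0 < a + \<epsilon> * b"
      with order_tendstoD(2)[OF lim 2] have "\<forall>\<^sub>F \<epsilon> in at_right (0::real). False"
        by eventually_elim simp
      then show False by simp
    qed
    then show ?thesis using 2 by simp
  next
    case 3
    have "(\<forall>\<^sub>F \<epsilon> in at_right 0. 0 < \<epsilon> * b) \<longleftrightarrow> (\<forall>\<^sub>F \<epsilon> in at_right (0::real). 0 < b)"
      by (rule eventually_cong[OF pos]) (simp add: zero_less_mult_iff)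
    then show ?thesis using 3 by (simp add: eventually_const)
  qed
qed

text \<open>For a basis \<open>S\<close> this is the closed simplicial cone without the facets
  across which \<open>q\<close> does not point strictly inwards. The sign form is the one that
  division with remainder can use.\<close>

definition half_open_cone :: "'a::real_vector \<Rightarrow> 'a set \<Rightarrow> 'a set" where
  "half_open_cone q S =
    {x. \<forall>v\<in>S. 0 < representation S x v \<or> representation S x v = 0 \<and> 0 < representation S q v}"

context
  fixes S :: "'a::euclidean_space set"
  assumes indep: "independent S" and spanning: "span S = UNIV"
begin

lemma finite_spanning_independent: "finite S"
  using indep by (rule independent_imp_finite)

lemma sum_representation: "(\<Sum>v\<in>S. representation S x v *\<^sub>R v) = x"
  using finite_spanning_independent indep spanning by (intro sum_representation_eq) auto

lemma representation_sum_scale: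
  assumes "v \<in> S"
  shows "representation S (\<Sum>w\<in>S. c w *\<^sub>R w) v = c v"
proof -
  have "representation S (\<Sum>w\<in>S. c w *\<^sub>R w) = (\<lambda>u. \<Sum>w\<in>S. representation S (c w *\<^sub>R w) u)"
    using indep spanning by (intro representation_sum) auto
  then have "representation S (\<Sum>w\<in>S. c w *\<^sub>R w) v = (\<Sum>w\<in>S. representation S (c w *\<^sub>R w) v)"
    by simp
  also have "\<dots> = (\<Sum>w\<in>S. if w = v then c w else 0)"
    using indep spanning
    by (intro sum.cong) (auto simp: representation_scale representation_basis)
  finally show ?thesis using assms finite_spanning_independent by simp
qed

lemma representation_add_scale:
  "representation S (x + t *\<^sub>R y) v = representation S x v + t * representation S y v"
  using indep spanning by (simp add: representation_add representation_scale)

lemma open_cone_iff: "x \<in> open_cone S \<longleftrightarrow> (\<forall>v\<in>S. 0 < representation S x v)"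
proof
  assume "x \<in> open_cone S"
  then show "\<forall>v\<in>S. 0 < representation S x v"
    by (auto simp: open_cone_def representation_sum_scale)
next
  assume "\<forall>v\<in>S. 0 < representation S x v"
  then have "(\<Sum>v\<in>S. representation S x v *\<^sub>R v) \<in> open_cone S" by (intro open_coneI) auto
  then show "x \<in> open_cone S" by (simp add: sum_representation)
qed

text \<open>This form lets disjointness and covering be inherited from the open cones, by looking at
  points slightly further along \<open>q\<close>.\<close>

lemma half_open_cone_iff:
  "x \<in> half_open_cone q S \<longleftrightarrow> (\<forall>\<^sub>F \<epsilon> in at_right 0. x + \<epsilon> *\<^sub>R q \<in> open_cone S)"
  by (simp add: half_open_cone_def open_cone_iff representation_add_scale
      eventually_ball_finite_distrib[OF finite_spanning_independent] eventually_at_right_affine_pos_iff)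

lemma half_open_cone_subset_hull:
  assumes "S \<subseteq> G"
  shows "half_open_cone q S \<subseteq> convex_cone hull G"
proof
  fix x assume "x \<in> half_open_cone q S"
  then have "(\<Sum>v\<in>S. representation S x v *\<^sub>R v) \<in> convex_cone hull G"
    using assms by (intro convex_cone_hull_sum) (auto simp: half_open_cone_def hull_inc)
  then show "x \<in> convex_cone hull G" by (simp add: sum_representation)
qed

end

text \<open>Each point \<open>x\<close> is assigned to the simplicial cone that the ray from \<open>x\<close> in the generic
  direction \<open>q\<close> enters first.\<close>

lemma half_open_cone_partition:
  fixes G :: "'a::euclidean_space set"
  assumes "finite G" "interior (convex_cone hull G) \<noteq> {}"
  obtains D q where "D \<subseteq> Pow G" "\<And>S. S \<in> D \<Longrightarrow> independent S" "\<And>S. S \<in> D \<Longrightarrow> span S = UNIV"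
    "q \<in> convex_cone hull G"
    "disjoint_family_on (half_open_cone q) D"
    "(\<Union>S\<in>D. half_open_cone q S) = convex_cone hull G"
proof -
  let ?C = "convex_cone hull G"
  obtain D where D: "D \<subseteq> Pow G" "\<And>S. S \<in> D \<Longrightarrow> independent S"
      "disjoint_family_on open_cone D" "(\<Union>S\<in>D. open_cone S) = ?C"
    using cone_triangulation[OF assms(1)] by metis
  obtain q where q: "q \<in> ?C" "\<And>S. S \<subseteq> G \<Longrightarrow> q \<in> span S \<Longrightarrow> span S = UNIV"
    using generic_vector[OF assms] by metis
  \<comment> \<open>Only a full-dimensional cell can contain a segment in the generic direction
    \<open>q\<close>.\<close>
  define D' where "D' = {S \<in> D. span S = UNIV}"
  have D': "independent S" "span S = UNIV" "S \<in> D" "S \<subseteq> G" if "S \<in> D'" for S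
    using that D(1,2) unfolding D'_def by auto
  have finD: "finite D" by (rule finite_subset[OF D(1)]) (simp add: assms(1))
  have disj: "half_open_cone q S \<inter> half_open_cone q T = {}"
    if "S \<in> D'" "T \<in> D'" "S \<noteq> T" for S T
  proof -
    have False if "x \<in> half_open_cone q S" "x \<in> half_open_cone q T" for x
    proof -
      have "\<forall>\<^sub>F \<epsilon> in at_right 0. x + \<epsilon> *\<^sub>R q \<in> open_cone S \<and> x + \<epsilon> *\<^sub>R q \<in> open_cone T"
        using that \<open>S \<in> D'\<close> \<open>T \<in> D'\<close> by (simp add: half_open_cone_iff D' eventually_conj_iff)
      from eventually_happens'[OF trivial_limit_at_right_real this]
      have "open_cone S \<inter> open_cone T \<noteq> {}" by blast
      moreover have "open_cone S \<inter> open_cone T = {}"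
        by (rule disjoint_family_onD[OF D(3) D'(3)[OF \<open>S \<in> D'\<close>] D'(3)[OF \<open>T \<in> D'\<close>] \<open>S \<noteq> T\<close>])
      ultimately show False by contradiction
    qed
    then show ?thesis by blast
  qed
  have cover: "\<exists>S\<in>D'. x \<in> half_open_cone q S" if x: "x \<in> ?C" for x
  proof -
    have "\<exists>S\<in>D. \<forall>\<^sub>F \<epsilon> in at_right 0. x + \<epsilon> *\<^sub>R q \<in> open_cone S"
    proof (rule ccontr)
      assume none: "\<not> ?thesis"
      have "\<forall>\<^sub>F \<epsilon> in at_right 0. x + \<epsilon> *\<^sub>R q \<notin> open_cone S" if S: "S \<in> D" for S
      proof (rule ccontr)
        \<comment> \<open>The ray meets the cell at parameters arbitrarily close to 0; by convexity
          it then stays in the cell near 0, against \<open>none\<close>. So the ray is eventually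
          outside each of the finitely many cells, although it never leaves the cone.\<close>
        assume freq: "\<not> ?thesis"
        then have freq: "\<exists>y>0. y < b \<and> x + y *\<^sub>R q \<in> open_cone S" if "b > 0" for b
          using that unfolding eventually_at_right_field by blast
        obtain b where b: "b > 0" "x + b *\<^sub>R q \<in> open_cone S" using freq[of 1] by auto
        have "x + y *\<^sub>R q \<in> open_cone S" if y: "0 < y" "y < b" for y
        proof -
          obtain a where a: "0 < a" "a < y" "x + a *\<^sub>R q \<in> open_cone S" using freq[OF y(1)] by blast
          define t where "t = (y - a) / (b - a)"
          have t: "0 \<le> t" "t \<le> 1" using a y by (auto simp: t_def)
          have "(1 - t) *\<^sub>R (x + a *\<^sub>R q) + t *\<^sub>R (x + b *\<^sub>R q) \<in> open_cone S"
            using t by (intro convexD[OF convex_open_cone a(3) b(2)]) auto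
          also have "(1 - t) *\<^sub>R (x + a *\<^sub>R q) + t *\<^sub>R (x + b *\<^sub>R q) = x + (a + t * (b - a)) *\<^sub>R q"
            by (simp add: algebra_simps)
          also have "a + t * (b - a) = y" using a y by (simp add: t_def)
          finally show ?thesis .
        qed
        then have "\<forall>\<^sub>F \<epsilon> in at_right 0. x + \<epsilon> *\<^sub>R q \<in> open_cone S"
          unfolding eventually_at_right_field using b(1) by blast
        then show False using none S by blast
      qed
      then have "\<forall>\<^sub>F \<epsilon> in at_right 0. \<forall>S\<in>D. x + \<epsilon> *\<^sub>R q \<notin> open_cone S"
        using finD by (simp add: eventually_ball_finite)
      moreover have "\<forall>\<^sub>F \<epsilon> in at_right 0. (0::real) < \<epsilon>" by (rule eventually_at_right_less)
      ultimately have "\<forall>\<^sub>F \<epsilon> in at_right (0::real). False"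
      proof eventually_elim
        case (elim \<epsilon>)
        have "x + \<epsilon> *\<^sub>R q \<in> ?C"
          using x q(1) elim(2) by (intro convex_cone_hull_add convex_cone_hull_mul) auto
        then show ?case using elim(1) D(4) by blast
      qed
      then show False by simp
    qed
    then obtain S where S: "S \<in> D" "\<forall>\<^sub>F \<epsilon> in at_right 0. x + \<epsilon> *\<^sub>R q \<in> open_cone S" by blast
    then obtain b where b: "b > 0" "\<And>y. 0 < y \<Longrightarrow> y < b \<Longrightarrow> x + y *\<^sub>R q \<in> open_cone S"
      unfolding eventually_at_right_field by blast
    have "x + (b/2) *\<^sub>R q \<in> span S" "x + (b/3) *\<^sub>R q \<in> span S"
      using b open_cone_subset_span by (auto intro!: subsetD[OF open_cone_subset_span])
    \<comment> \<open>Two points of the ray in one cell have a nonzero multiple of \<open>q\<close>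
      as difference; 6 / b inverts b/2 - b/3.\<close>
    then have "(6 / b) *\<^sub>R ((x + (b/2) *\<^sub>R q) - (x + (b/3) *\<^sub>R q)) \<in> span S"
      by (intro span_scale span_diff)
    also have "(6 / b) *\<^sub>R ((x + (b/2) *\<^sub>R q) - (x + (b/3) *\<^sub>R q)) = q"
      using b(1) by (simp flip: scaleR_left_diff_distrib add: field_simps)
    finally have "S \<in> D'" using q(2) S(1) D(1) unfolding D'_def by auto
    then show ?thesis using S(2) by (auto simp: half_open_cone_iff D')
  qed
  show thesis
  proof
    show "D' \<subseteq> Pow G" using D(1) D'_def by blast
    show "disjoint_family_on (half_open_cone q) D'" using disj by (simp add: disjoint_family_on_def)
    have "half_open_cone q S \<subseteq> ?C" if "S \<in> D'" for S
      using half_open_cone_subset_hull[OF D'(1,2,4)] that by blast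
    then show "(\<Union>S\<in>D'. half_open_cone q S) = ?C" using cover by blast
  qed (use q D' in auto)
qed

section \<open>Lattice points of cones\<close>

text \<open>This is the polynomial \<open>(m - h + d) choose d\<close> in \<open>m\<close>. For \<open>h \<le> d\<close> it vanishes at
  \<open>0 \<le> m < h\<close>, so that it counts correctly at every natural number and not only at large ones.\<close>

definition shifted_binomial_poly :: "nat \<Rightarrow> nat \<Rightarrow> real poly" where
  "shifted_binomial_poly d h = smult (1 / fact d) (\<Prod>i<d. [:real i + 1 - real h, 1:])"

lemma poly_shifted_binomial_poly:
  assumes "h \<le> d"
  shows "poly (shifted_binomial_poly d h) (real m) =
    (if h \<le> m then real ((d + (m - h)) choose (m - h)) else 0)"
proof (cases "h \<le> m")
  case True
  define n where "n = m - h"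
  have m: "m = n + h" using True by (simp add: n_def)
  have "poly (shifted_binomial_poly d h) (real m) = (\<Prod>i<d. real n + 1 + real i) / fact d"
    by (simp add: shifted_binomial_poly_def poly_prod m algebra_simps)
  also have "(\<Prod>i<d. real n + 1 + real i) = pochhammer (1 + real n) d"
    by (simp add: pochhammer_prod lessThan_atLeast0 add.commute)
  also have "\<dots> = fact (n + d) / fact n"
    using pochhammer_product'[of "1 :: real" n d] by (simp flip: pochhammer_fact add: field_simps)
  also have "\<dots> / fact d = real ((d + n) choose n)"
    by (subst binomial_fact) (auto simp: add.commute)
  finally show ?thesis using True by (simp add: n_def)
next
  case False
  \<comment> \<open>The factor of index \<open>h - m - 1\<close> vanishes at m; the hypothesis on
    \<open>h\<close> puts this index in range.\<close>
  then have "poly [:real (h - m - 1) + 1 - real h, 1:] (real m) = 0"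
    by (simp add: of_nat_diff)
  moreover have "h - m - 1 < d" using False assms by simp
  ultimately have "(\<Prod>i<d. poly [:real i + 1 - real h, 1:] (real m)) = 0"
    by (subst prod_zero_iff) auto
  then show ?thesis using False by (simp add: shifted_binomial_poly_def poly_prod)
qed

text \<open>At -1 the factors become i - h for i < d: one of them is 0 if h < d, and for h = d the
  product is (-1)^d d!.\<close>

lemma poly_shifted_binomial_poly_minus_one:
  assumes "h \<le> d"
  shows "poly (shifted_binomial_poly d h) (-1) \<in> \<int>"
proof (cases "h = d")
  case True
  have "(\<Prod>i<d. real i - real d) = (\<Prod>i<d. (-1) * real (d - i))"
    by (intro prod.cong) (auto simp: of_nat_diff)
  also have "\<dots> = (\<Prod>i<d. -1) * (\<Prod>i<d. real (d - i))"
    by (rule prod.distrib)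
  also have "\<dots> = (-1) ^ d * fact d"
    by (simp add: fact_prod_rev lessThan_atLeast0)
  finally show ?thesis
    using True by (simp add: shifted_binomial_poly_def poly_prod)
next
  case False
  then have zero: "(\<Prod>i<d. real i - real h) = 0"
    using assms by (subst prod_zero_iff) auto
  have "poly (shifted_binomial_poly d h) (-1) = (\<Prod>i<d. real i - real h) / fact d"
    by (simp add: shifted_binomial_poly_def poly_prod)
  then show ?thesis by (simp only: zero) simp
qed

lemma degree_shifted_binomial_poly: "degree (shifted_binomial_poly d h) = d"
  by (simp add: shifted_binomial_poly_def degree_prod_sum_eq)

lemma coeff_shifted_binomial_poly: "coeff (shifted_binomial_poly d h) d = 1 / fact d"
proof -
  have "lead_coeff (shifted_binomial_poly d h) = 1 / fact d"
    by (simp add: shifted_binomial_poly_def lead_coeff_prod)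
  then show ?thesis by (simp add: degree_shifted_binomial_poly)
qed

text \<open>A discrete subgroup graded by a linear height. It will be instantiated by the integer
  lattice of one dimension more, with the last coordinate as height.\<close>

locale graded_lattice =
  fixes L :: "'a::euclidean_space set" and ht :: "'a \<Rightarrow> real"
  assumes zero: "0 \<in> L"
    and add: "x \<in> L \<Longrightarrow> y \<in> L \<Longrightarrow> x + y \<in> L"
    and diff: "x \<in> L \<Longrightarrow> y \<in> L \<Longrightarrow> x - y \<in> L"
    and finite_bounded: "bounded B \<Longrightarrow> finite (B \<inter> L)"
    and linear_ht: "linear ht"
    and ht_Ints: "x \<in> L \<Longrightarrow> ht x \<in> \<int>"
begin

lemma nat_combination:
  assumes "S \<subseteq> L"
  shows "(\<Sum>v\<in>S. real (n v) *\<^sub>R v) \<in> L"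
proof -
  have "real k *\<^sub>R v \<in> L" if "v \<in> L" for k v
    using that by (induction k) (auto simp: zero add scaleR_left_distrib)
  then show ?thesis
    using assms by (induction S rule: infinite_finite_induct) (auto simp: zero add)
qed

text \<open>Because \<open>q\<close> has a positive coordinate, the box omits the vertex \<open>\<Sum>S\<close>, hence its
  points have height at most \<open>DIM('a) - 1\<close>.\<close>

definition fund_box :: "'a \<Rightarrow> 'a set \<Rightarrow> 'a set" where
  "fund_box q S = {b \<in> L. \<forall>v\<in>S.
     if 0 < representation S q v then 0 \<le> representation S b v \<and> representation S b v < 1
     else 0 < representation S b v \<and> representation S b v \<le> 1}"

definition level :: "'a \<Rightarrow> nat" where
  "level b = nat \<lfloor>ht b\<rfloor>"

context
  fixes S :: "'a set" and q :: 'a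
  assumes indep: "independent S" and spanning: "span S = UNIV"
    and lattice: "S \<subseteq> L" and height_one: "\<And>v. v \<in> S \<Longrightarrow> ht v = 1"
    and ht_q: "0 < ht q"
begin

lemmas finS = finite_spanning_independent[OF indep spanning]
lemmas repr = sum_representation[OF indep spanning]

lemma card_S: "card S = DIM('a)"
  using dim_span[of S] indep spanning by (simp add: dim_eq_card_independent)

lemma ht_combination: "ht (\<Sum>v\<in>S. c v *\<^sub>R v) = (\<Sum>v\<in>S. c v)"
  by (simp add: linear_sum[OF linear_ht] linear_cmul[OF linear_ht] height_one)

lemma ht_eq_sum: "ht x = (\<Sum>v\<in>S. representation S x v)"
  using ht_combination[of "representation S x"] unfolding repr .

lemma box_bounds:
  assumes "b \<in> fund_box q S" "v \<in> S"
  shows "0 \<le> representation S b v" "representation S b v \<le> 1"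
proof -
  have "if 0 < representation S q v then 0 \<le> representation S b v \<and> representation S b v < 1
      else 0 < representation S b v \<and> representation S b v \<le> 1"
    using assms unfolding fund_box_def by blast
  then show "0 \<le> representation S b v" "representation S b v \<le> 1"
    by (simp_all split: if_splits)
qed

lemma finite_box: "finite (fund_box q S)"
proof -
  have "norm b \<le> (\<Sum>v\<in>S. norm v)" if "b \<in> fund_box q S" for b
  proof -
    have "norm b = norm (\<Sum>v\<in>S. representation S b v *\<^sub>R v)" by (simp add: repr)
    also have "\<dots> \<le> (\<Sum>v\<in>S. norm (representation S b v *\<^sub>R v))" by (rule norm_sum)
    also have "\<dots> \<le> (\<Sum>v\<in>S. norm v)"
      using box_bounds[OF that] by (intro sum_mono) (auto intro: mult_left_le_one_le)
    finally show ?thesis .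
  qed
  then have "bounded (fund_box q S)" by (auto simp: bounded_iff)
  then have "finite (fund_box q S \<inter> L)" by (rule finite_bounded)
  moreover have "fund_box q S \<inter> L = fund_box q S" by (auto simp: fund_box_def)
  ultimately show ?thesis by simp
qed

lemma
  assumes b: "b \<in> fund_box q S"
  shows ht_box: "ht b = real (level b)" and level_box: "level b \<le> DIM('a) - 1"
proof -
  have "0 \<le> ht b" unfolding ht_eq_sum using box_bounds(1)[OF b] by (rule sum_nonneg)
  moreover have "ht b \<in> \<int>" using b ht_Ints by (auto simp: fund_box_def)
  ultimately show ht: "ht b = real (level b)" by (auto simp: level_def elim!: Ints_cases)
  \<comment> \<open>The height of \<open>q\<close> is the sum of its coordinates, so they cannot all
    be nonpositive.\<close>
  obtain v where v: "v \<in> S" "0 < representation S q v"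
    using ht_q unfolding ht_eq_sum[of q] by (meson not_less sum_nonpos)
  then have "representation S b v < 1" using b by (auto simp: fund_box_def)
  then have "ht b < (\<Sum>v\<in>S. 1)"
    unfolding ht_eq_sum using v box_bounds(2)[OF b] finS by (intro sum_strict_mono_ex1) auto
  then have "level b < DIM('a)" using ht card_S by simp
  then show "level b \<le> DIM('a) - 1" by simp
qed

lemma sum_count:
  assumes "set_mset M \<subseteq> S"
  shows "(\<Sum>v\<in>S. count M v) = size M"
  unfolding size_multiset_overloaded_eq using assms finS
  by (intro sum.mono_neutral_right) (auto simp: not_in_iff)

lemma representation_add_count:
  assumes "v \<in> S"
  shows "representation S (b + (\<Sum>w\<in>S. real (c w) *\<^sub>R w)) v = representation S b v + real (c v)"
  using representation_add_scale[OF indep spanning, of b 1 "\<Sum>w\<in>S. real (c w) *\<^sub>R w" v]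
    representation_sum_scale[OF indep spanning assms, of "\<lambda>w. real (c w)"] by simp

text \<open>Division with remainder in each coordinate: the remainders form the box point, the
  integer parts the multiplicities. Multisets encode the latter because their total is fixed by the
  height, and the number of multisets of a given size is a binomial.\<close>

lemma bij_betw_half_open_cone:
  "bij_betw (\<lambda>(b, M). b + (\<Sum>v\<in>S. real (count M v) *\<^sub>R v))
     (SIGMA b:{b \<in> fund_box q S. level b \<le> m}. multisets_of_size S (m - level b))
     {x \<in> L \<inter> half_open_cone q S. ht x = real m}"
  (is "bij_betw ?f ?A ?B")
proof (rule bij_betw_imageI)
  show "inj_on ?f ?A"
  proof (rule inj_onI)
    fix p p' assume "p \<in> ?A" "p' \<in> ?A" and eq: "?f p = ?f p'"
    moreover obtain b M b' M' where p: "p = (b, M)" "p' = (b', M')" by fastforce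
    ultimately have b: "b \<in> fund_box q S" "b' \<in> fund_box q S" and M: "set_mset M \<subseteq> S" "set_mset M' \<subseteq> S"
      by (auto simp: multisets_of_size_def)
    have count: "count M v = count M' v" if v: "v \<in> S" for v
    proof -
      have "representation S b v + real (count M v) = representation S b' v + real (count M' v)"
        using eq representation_add_count[OF v] by (simp add: p) metis
      \<comment> \<open>Both remainders lie in the same half-open unit interval, so integer parts
        must agree.\<close>
      moreover have "\<bar>representation S b v - representation S b' v\<bar> < 1"
      proof (cases "0 < representation S q v")
        case True
        then have "0 \<le> representation S b v" "representation S b v < 1"
          "0 \<le> representation S b' v" "representation S b' v < 1"
          using b v by (auto simp: fund_box_def)
        then show ?thesis by linarith
      next
        case False
        then have "0 < representation S b v" "representation S b v \<le> 1"
          "0 < representation S b' v" "representation S b' v \<le> 1"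
          using b v by (auto simp: fund_box_def)
        then show ?thesis by linarith
      qed
      ultimately show ?thesis by linarith
    qed
    have "M = M'"
    proof (rule multiset_eqI)
      show "count M v = count M' v" for v
        using count M by (metis not_in_iff subsetD)
    qed
    then show "p = p'" using eq p by simp
  qed
  show "?f ` ?A = ?B"
  proof (intro equalityI subsetI)
    fix x assume "x \<in> ?f ` ?A"
    then obtain b M where b: "b \<in> fund_box q S" "level b \<le> m" and M: "set_mset M \<subseteq> S" "size M = m - level b"
      and x: "x = b + (\<Sum>v\<in>S. real (count M v) *\<^sub>R v)"
      by (auto simp: multisets_of_size_def)
    have "ht x = ht b + real (\<Sum>v\<in>S. count M v)"
      by (simp add: x linear_add[OF linear_ht] ht_combination)
    also have "\<dots> = real m" using b M by (simp add: ht_box sum_count)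
    finally have "ht x = real m" .
    moreover have "x \<in> L" unfolding x using b(1) nat_combination[OF lattice] by (auto simp: fund_box_def add)
    moreover have "x \<in> half_open_cone q S"
      using b(1) by (fastforce simp: half_open_cone_def x representation_add_count fund_box_def split: if_splits)
    ultimately show "x \<in> ?B" by simp
  next
    fix x assume x: "x \<in> ?B"
    \<comment> \<open>Floor leaves a remainder in [0,1), ceiling minus one a remainder in (0,1]. In
      the second case the coordinate of \<open>x\<close> is strictly positive, so \<open>nat\<close>
      truncates nothing.\<close>
    define n where "n v = (if 0 < representation S q v then nat \<lfloor>representation S x v\<rfloor>
      else nat (\<lceil>representation S x v\<rceil> - 1))" for v
    define M where "M = (\<Sum>v\<in>S. replicate_mset (n v) v)"
    define b where "b = x - (\<Sum>v\<in>S. real (n v) *\<^sub>R v)"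
    have count: "count M v = n v" if "v \<in> S" for v
      using that finS by (simp add: M_def count_sum if_distrib cong: if_cong)
    have M: "set_mset M \<subseteq> S" using finS by (auto simp: M_def set_mset_sum split: if_splits)
    have xb: "x = b + (\<Sum>v\<in>S. real (n v) *\<^sub>R v)" by (simp add: b_def)
    have b: "b \<in> fund_box q S" unfolding fund_box_def
    proof (intro CollectI conjI ballI)
      show "b \<in> L" unfolding b_def using x nat_combination[OF lattice] by (intro diff) auto
      fix v assume v: "v \<in> S"
      have rb: "representation S b v = representation S x v - real (n v)"
        using representation_add_count[OF v, of b n] by (simp flip: xb)
      have "0 < representation S x v \<or> representation S x v = 0 \<and> 0 < representation S q v"
        using x v by (simp add: half_open_cone_def)
      then show "if 0 < representation S q v then 0 \<le> representation S b v \<and> representation S b v < 1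
         else 0 < representation S b v \<and> representation S b v \<le> 1"
        unfolding rb n_def by (auto; linarith)
    qed
    have "real (level b) + real (size M) = real m"
    proof -
      have "real m = ht x" using x by simp
      also have "\<dots> = ht b + ht (\<Sum>v\<in>S. real (n v) *\<^sub>R v)"
        by (subst xb) (rule linear_add[OF linear_ht])
      also have "\<dots> = real (level b) + real (\<Sum>v\<in>S. count M v)"
        by (simp add: ht_box[OF b] ht_combination count)
      finally show ?thesis by (simp only: sum_count[OF M])
    qed
    then have "(b, M) \<in> ?A" using b M by (auto simp: multisets_of_size_def)
    moreover have "x = ?f (b, M)" using xb by (simp add: count)
    ultimately show "x \<in> ?f ` ?A" by blast
  qed
qed

lemma finite_half_open_cone_slice: "finite {x \<in> L \<inter> half_open_cone q S. ht x = real m}"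
  by (rule bij_betw_finite[OF bij_betw_half_open_cone, THEN iffD1])
     (auto simp: finite_box finS intro!: finite_SigmaI finite_multisets_of_size)

lemma card_half_open_cone_slice:
  "real (card {x \<in> L \<inter> half_open_cone q S. ht x = real m}) =
     (\<Sum>b\<in>fund_box q S. poly (shifted_binomial_poly (DIM('a) - 1) (level b)) (real m))"
proof -
  let ?B = "{b \<in> fund_box q S. level b \<le> m}"
  have "card {x \<in> L \<inter> half_open_cone q S. ht x = real m} =
      card (SIGMA b:?B. multisets_of_size S (m - level b))"
    using bij_betw_same_card[OF bij_betw_half_open_cone] by simp
  also have "\<dots> = (\<Sum>b\<in>?B. card (multisets_of_size S (m - level b)))"
    by (rule card_SigmaI) (auto simp: finite_box finS intro!: finite_multisets_of_size)
  finally have "real (card {x \<in> L \<inter> half_open_cone q S. ht x = real m}) =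
      (\<Sum>b\<in>?B. real ((DIM('a) - 1 + (m - level b)) choose (m - level b)))"
    by (simp add: card_multisets_of_size finS card_S)
  \<comment> \<open>Box points above height m return with the value 0, which is what their
    polynomial takes at m.\<close>
  also have "\<dots> = (\<Sum>b\<in>fund_box q S. if level b \<le> m
      then real ((DIM('a) - 1 + (m - level b)) choose (m - level b)) else 0)"
    using finite_box by (rule sum.inter_filter)
  also have "\<dots> = (\<Sum>b\<in>fund_box q S. poly (shifted_binomial_poly (DIM('a) - 1) (level b)) (real m))"
    by (intro sum.cong refl) (simp only: poly_shifted_binomial_poly level_box)
  finally show ?thesis .
qed

end

text \<open>The polynomial is the sum of one shifted binomial per box point of every cell; the
  positive common leading coefficient fixes the degree once some box point exists.\<close>

theorem ehrhart_cone:
  fixes G :: "'a set"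
  assumes "finite G" "interior (convex_cone hull G) \<noteq> {}" "G \<subseteq> L" "\<And>v. v \<in> G \<Longrightarrow> ht v = 1"
  obtains R :: "real poly" where "degree R = DIM('a) - 1" "poly R (-1) \<in> \<int>"
    "\<And>m. poly R (real m) = real (card {x \<in> L \<inter> convex_cone hull G. ht x = real m})"
proof -
  let ?C = "convex_cone hull G" and ?d = "DIM('a) - 1"
  obtain D q where D: "D \<subseteq> Pow G" "\<And>S. S \<in> D \<Longrightarrow> independent S" "\<And>S. S \<in> D \<Longrightarrow> span S = UNIV"
      "disjoint_family_on (half_open_cone q) D" "(\<Union>S\<in>D. half_open_cone q S) = ?C"
    using half_open_cone_partition[OF assms(1,2)] by metis
  have finD: "finite D" by (rule finite_subset[OF D(1)]) (simp add: assms(1))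
  have SL: "S \<subseteq> L" "\<And>v. v \<in> S \<Longrightarrow> ht v = 1" if "S \<in> D" for S
    using that D(1) assms(3,4) by blast+
  have "0 \<in> ?C" by (rule convex_cone_hull_contains_0)
  then obtain S where S: "S \<in> D" "0 \<in> half_open_cone q S" using D(5) by blast
  \<comment> \<open>All coordinates of 0 vanish, so in the cell that contains 0 every coordinate of
    \<open>q\<close> must be positive.\<close>
  have "0 < ht q"
  proof -
    have "S \<noteq> {}"
    proof
      assume "S = {}"
      then have "dim (span ({} :: 'a set)) = DIM('a)" using D(3)[OF S(1)] by (simp only: dim_UNIV)
      then show False by simp
    qed
    moreover have "0 < representation S q v" if "v \<in> S" for v
      using S(2) that by (simp add: half_open_cone_def representation_zero)
    ultimately have "0 < (\<Sum>v\<in>S. representation S q v)"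
      using finite_spanning_independent[OF D(2,3)[OF S(1)]] by (intro sum_pos) auto
    also have "\<dots> = ht (\<Sum>v\<in>S. representation S q v *\<^sub>R v)"
      using SL(2)[OF S(1)] by (simp add: linear_sum[OF linear_ht] linear_cmul[OF linear_ht])
    finally show ?thesis by (simp add: sum_representation[OF D(2,3)[OF S(1)]])
  qed
  note facts = D(2) D(3) SL \<open>0 < ht q\<close>
  have finite_box: "finite (fund_box q S)" if "S \<in> D" for S
    by (rule finite_box) (use facts that in auto)
  have finite_slice: "finite {x \<in> L \<inter> half_open_cone q S. ht x = real m}" if "S \<in> D" for S m
    by (rule finite_half_open_cone_slice) (use facts that in auto)
  have card_slice: "real (card {x \<in> L \<inter> half_open_cone q S. ht x = real m}) =
      (\<Sum>b\<in>fund_box q S. poly (shifted_binomial_poly (DIM('a) - 1) (level b)) (real m))" if "S \<in> D" for S m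
    by (rule card_half_open_cone_slice) (use facts that in auto)
  have level_box: "level b \<le> DIM('a) - 1" if "S \<in> D" "b \<in> fund_box q S" for S b
    by (rule level_box[OF _ _ _ _ _ that(2)]) (use facts that in auto)
  let ?A = "SIGMA S:D. fund_box q S"
  define R where "R = (\<Sum>p\<in>?A. shifted_binomial_poly ?d (level (snd p)))"
  have finA: "finite ?A" using finD finite_box by (intro finite_SigmaI)
  have lev: "level (snd p) \<le> ?d" if "p \<in> ?A" for p
    using that level_box by auto
  have R: "poly R (real m) = real (card {x \<in> L \<inter> ?C. ht x = real m})" for m
  proof -
    have "{x \<in> L \<inter> ?C. ht x = real m} = (\<Union>S\<in>D. {x \<in> L \<inter> half_open_cone q S. ht x = real m})"
      using D(5) by blast
    moreover have "card (\<Union>S\<in>D. {x \<in> L \<inter> half_open_cone q S. ht x = real m}) =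
        (\<Sum>S\<in>D. card {x \<in> L \<inter> half_open_cone q S. ht x = real m})"
    proof (rule card_UN_disjoint[OF finD])
      show "\<forall>S\<in>D. finite {x \<in> L \<inter> half_open_cone q S. ht x = real m}"
        using finite_slice by simp
      show "\<forall>S\<in>D. \<forall>T\<in>D. S \<noteq> T \<longrightarrow> {x \<in> L \<inter> half_open_cone q S. ht x = real m} \<inter>
          {x \<in> L \<inter> half_open_cone q T. ht x = real m} = {}"
        using D(4) unfolding disjoint_family_on_def by blast
    qed
    ultimately have "card {x \<in> L \<inter> ?C. ht x = real m} =
        (\<Sum>S\<in>D. card {x \<in> L \<inter> half_open_cone q S. ht x = real m})"
      by (simp only:)
    also have "real \<dots> = (\<Sum>S\<in>D. \<Sum>b\<in>fund_box q S. poly (shifted_binomial_poly ?d (level b)) (real m))"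
      unfolding of_nat_sum by (rule sum.cong[OF refl card_slice])
    also have "\<dots> = poly R (real m)"
      unfolding R_def poly_sum using finD finite_box
      by (subst sum.Sigma) (auto simp: case_prod_beta)
    finally show ?thesis by simp
  qed
  have coeff: "coeff R ?d = real (card ?A) / fact ?d"
    by (simp add: R_def coeff_sum coeff_shifted_binomial_poly)
  \<comment> \<open>Without box points R(0) would be 0, but the slice of height 0 contains the
    origin. Its finiteness matters because \<open>card\<close> is 0 on infinite sets.\<close>
  have "?A \<noteq> {}"
  proof
    assume "?A = {}"
    then have "poly R (real 0) = 0" by (simp only: R_def sum.empty poly_0)
    moreover have "0 \<in> {x \<in> L \<inter> ?C. ht x = real 0}"
      by (simp add: zero convex_cone_hull_contains_0 linear_0[OF linear_ht])
    moreover have "finite {x \<in> L \<inter> ?C. ht x = real 0}"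
    proof -
      have "{x \<in> L \<inter> ?C. ht x = real 0} = (\<Union>S\<in>D. {x \<in> L \<inter> half_open_cone q S. ht x = real 0})"
        using D(5) by blast
      then show ?thesis using finD finite_slice[of _ 0] by simp
    qed
    ultimately show False unfolding R by (auto simp: card_eq_0_iff)
  qed
  then have "coeff R ?d \<noteq> 0" using finA coeff by (simp add: card_eq_0_iff)
  moreover have "degree R \<le> ?d"
    unfolding R_def by (intro degree_sum_le finA) (simp add: degree_shifted_binomial_poly)
  ultimately have "degree R = ?d" by (simp add: le_degree le_antisym)
  moreover have "poly R (-1) \<in> \<int>"
    unfolding R_def poly_sum by (intro Ints_sum poly_shifted_binomial_poly_minus_one lev)
  ultimately show thesis using R by (intro that)
qed

end

section \<open>Lattice polytopes\<close>

lemma finite_bounded_int_lattice: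
  fixes B :: "(real ^ 'n) set"
  assumes "bounded B"
  shows "finite (B \<inter> int_lattice)"
proof -
  obtain K where K: "\<And>x. x \<in> B \<Longrightarrow> norm x \<le> K"
    using assms unfolding bounded_iff by metis
  define Z where "Z = {k::real. k \<in> \<int> \<and> \<bar>k\<bar> \<le> K}"
  have "finite ((\<lambda>f. \<chi> i. f i) ` (PiE (UNIV :: 'n set) (\<lambda>_. Z)))"
    unfolding Z_def by (intro finite_imageI finite_PiE finite_abs_int_segment) simp
  moreover have "B \<inter> int_lattice \<subseteq> (\<lambda>f. \<chi> i. f i) ` (PiE (UNIV :: 'n set) (\<lambda>_. Z))"
  proof
    fix x assume x: "x \<in> B \<inter> int_lattice"
    have "\<bar>x $ i\<bar> \<le> K" for i
      using component_le_norm_cart[of x i] K[of x] x by auto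
    then have "(\<lambda>i. x $ i) \<in> PiE UNIV (\<lambda>_. Z)" using x by (auto simp: Z_def int_lattice_def)
    then show "x \<in> (\<lambda>f. \<chi> i. f i) ` (PiE UNIV (\<lambda>_. Z))"
      by (rule rev_image_eqI) (simp add: vec_eq_iff)
  qed
  ultimately show ?thesis by (rule finite_subset[rotated])
qed

lemma graded_lattice_int_lattice:
  "graded_lattice ((int_lattice :: (real ^ 'n) set) \<times> (\<int> :: real set)) snd"
proof
  fix B :: "((real ^ 'n) \<times> real) set" assume B: "bounded B"
  then have "bounded (snd ` B)" by (rule bounded_snd)
  then obtain K where K: "\<And>x. x \<in> snd ` B \<Longrightarrow> norm x \<le> K"
    unfolding bounded_iff by metis
  have "B \<inter> int_lattice \<times> \<int> \<subseteq> (fst ` B \<inter> int_lattice) \<times> {k \<in> \<int>. \<bar>k\<bar> \<le> K}"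
  proof
    fix x assume x: "x \<in> B \<inter> int_lattice \<times> \<int>"
    moreover have "\<bar>snd x\<bar> \<le> K" using x K[of "snd x"] by simp
    ultimately show "x \<in> (fst ` B \<inter> int_lattice) \<times> {k \<in> \<int>. \<bar>k\<bar> \<le> K}"
      by (simp add: mem_Times_iff)
  qed
  moreover have "finite ((fst ` B \<inter> int_lattice) \<times> {k::real. k \<in> \<int> \<and> \<bar>k\<bar> \<le> K})"
    using B by (intro finite_cartesian_product finite_bounded_int_lattice bounded_fst finite_abs_int_segment)
  ultimately show "finite (B \<inter> int_lattice \<times> \<int>)" by (rule finite_subset)
qed (auto simp: int_lattice_def linear_snd zero_prod_def)

context
  fixes P :: "(real ^ 'n) set"
  assumes P: "lattice_polytope P"
begin

lemma lattice_polytope_imp_polytope: "polytope P" using P by (simp add: lattice_polytope_def)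

lemma lattice_polytope_interior_nonempty: "interior P \<noteq> {}"
proof -
  have "aff_dim P = int DIM(real ^ 'n)" using P by (simp add: lattice_polytope_def)
  then have "rel_interior P = interior P" by (rule interior_rel_interior)
  moreover have "P \<noteq> {}" using P by (auto simp: lattice_polytope_def)
  ultimately show ?thesis
    using polytope_imp_convex[OF lattice_polytope_imp_polytope] by (metis rel_interior_eq_empty)
qed

text \<open>The slice of the cone at height m is a copy of the dilate by m, and the extra dimension
  makes the degree \<open>CARD('n)\<close>.\<close>

lemma ehrhart_theorem:
  obtains R :: "real poly" where "degree R = CARD('n)" "poly R (-1) \<in> \<int>"
    "\<And>m. poly R (real m) = real (card ((\<lambda>x. real m *\<^sub>R x) ` P \<inter> int_lattice))"
proof -
  interpret graded_lattice "(int_lattice :: (real ^ 'n) set) \<times> (\<int> :: real set)" snd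
    by (rule graded_lattice_int_lattice)
  let ?L = "(int_lattice :: (real ^ 'n) set) \<times> (\<int> :: real set)"
  define V where "V = {v. v extreme_point_of P}"
  define G where "G = V \<times> {1::real}"
  let ?C = "convex_cone hull G"
  have V: "finite V" "V \<subseteq> int_lattice"
    unfolding V_def using P
    by (simp_all add: lattice_polytope_def finite_polyhedron_extreme_points polytope_imp_polyhedron)
  have hull_V: "convex hull V = P"
    unfolding V_def using lattice_polytope_imp_polytope
    by (intro Krein_Milman_Minkowski[symmetric] polytope_imp_compact polytope_imp_convex)
  have ne: "P \<noteq> {}" using lattice_polytope_interior_nonempty by auto
  then have "G \<noteq> {}" using hull_V by (auto simp: G_def)
  have "convex hull G = P \<times> {1}" by (simp add: G_def convex_hull_Times hull_V)
  then have "?C = (\<Union>x\<in>P \<times> {1}. \<Union>c\<in>{0..}. {c *\<^sub>R x})"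
    using convex_cone_hull_convex_hull_nonempty[OF \<open>G \<noteq> {}\<close>] by simp
  then have C: "(y, t) \<in> ?C \<longleftrightarrow> 0 \<le> t \<and> y \<in> (\<lambda>x. t *\<^sub>R x) ` P" for y t
    by auto
  \<comment> \<open>An open part of the cone: the points whose central projection to height 1 lands
    in the interior of \<open>P\<close>.\<close>
  define U where "U = {p :: (real ^ 'n) \<times> real. 0 < snd p} \<inter>
    (\<lambda>p. (1 / snd p) *\<^sub>R fst p) -` interior P"
  have "open U"
    unfolding U_def
    by (intro continuous_open_preimage open_Collect_less continuous_intros) auto
  moreover have "U \<subseteq> ?C"
  proof
    fix p assume p: "p \<in> U"
    then have "(1 / snd p) *\<^sub>R fst p \<in> P" "0 < snd p"
      using interior_subset by (auto simp: U_def)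
    then have "(fst p, snd p) \<in> ?C" unfolding C by (auto intro!: image_eqI[of _ _ "(1 / snd p) *\<^sub>R fst p"])
    then show "p \<in> ?C" by simp
  qed
  ultimately have "U \<subseteq> interior ?C" by (intro interior_maximal)
  moreover obtain x where "x \<in> interior P" using lattice_polytope_interior_nonempty by blast
  then have "(x, 1) \<in> U" by (simp add: U_def)
  ultimately have int: "interior ?C \<noteq> {}" by blast
  have G: "finite G" "G \<subseteq> ?L" using V by (auto simp: G_def)
  have height: "snd v = 1" if "v \<in> G" for v using that by (auto simp: G_def)
  obtain R :: "real poly" where R: "degree R = DIM((real ^ 'n) \<times> real) - 1" "poly R (-1) \<in> \<int>"
    "\<And>m. poly R (real m) = real (card {x \<in> ?L \<inter> ?C. snd x = real m})"
    by (rule ehrhart_cone[OF G(1) int G(2) height]) (assumption | rule that)+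
  have "{x \<in> ?L \<inter> ?C. snd x = real m} = (\<lambda>y. (y, real m)) ` ((\<lambda>x. real m *\<^sub>R x) ` P \<inter> int_lattice)" for m
  proof (rule set_eqI)
    fix p :: "(real ^ 'n) \<times> real"
    obtain y t where p: "p = (y, t)" by (rule prod.exhaust)
    show "p \<in> {x \<in> ?L \<inter> ?C. snd x = real m} \<longleftrightarrow>
        p \<in> (\<lambda>y. (y, real m)) ` ((\<lambda>x. real m *\<^sub>R x) ` P \<inter> int_lattice)"
      by (cases "t = real m") (simp_all add: p C inj_image_mem_iff inj_on_def image_iff conj_commute)
  qed
  moreover have "inj_on (\<lambda>y. (y, real m)) A" for m and A :: "(real ^ 'n) set"
    by (simp add: inj_on_def)
  ultimately have "card {x \<in> ?L \<inter> ?C. snd x = real m} = card ((\<lambda>x. real m *\<^sub>R x) ` P \<inter> int_lattice)" for m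
    by (simp only: card_image)
  then show thesis using R by (intro that) auto
qed

text \<open>Unit cubes attached to the lattice points of \<open>m *\<^sub>R P\<close> are disjoint, and
  all lie in a translate of \<open>(m + r) *\<^sub>R P\<close> for a constant \<open>r\<close>.\<close>

lemma card_dilate_le_volume:
  obtains r where "0 < r" "\<And>m. real (card ((\<lambda>x. real m *\<^sub>R x) ` P \<inter> int_lattice))
    \<le> (real m + r) ^ CARD('n) * measure lebesgue P"
proof -
  obtain p where "p \<in> interior P" using lattice_polytope_interior_nonempty by blast
  then obtain e where e: "0 < e" "cball p e \<subseteq> P" by (auto simp: mem_interior_cball)
  \<comment> \<open>Vectors of a unit cube have norm at most \<open>CARD('n)\<close>, so dividing
    them by \<open>r\<close> fits them into the ball of radius \<open>e\<close> around
    \<open>p\<close>.\<close>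
  define r where "r = real CARD('n) / e"
  have r: "0 < r" using e(1) by (simp add: r_def)
  have conv: "convex P" and comp: "compact P"
    using lattice_polytope_imp_polytope by (auto simp: polytope_imp_convex polytope_imp_compact)
  show thesis
  proof (rule that[OF r])
    fix m
    define N where "N = (\<lambda>x. real m *\<^sub>R x) ` P \<inter> int_lattice"
    define T where "T = (\<lambda>x. (real m + r) *\<^sub>R x + (- (r *\<^sub>R p))) ` P"
    have finN: "finite N"
      unfolding N_def using comp by (intro finite_bounded_int_lattice) (simp add: bounded_scaling compact_imp_bounded)
    have cube: "measure lebesgue (box z (z + 1)) = 1" for z :: "real ^ 'n"
    proof -
      have "(1 :: real ^ 'n) \<bullet> b = 1" if "b \<in> Basis" for b
        using that by (auto simp: Basis_vec_def inner_axis)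
      then show ?thesis by (simp add: inner_add_left)
    qed
    have "real (card N) = (\<Sum>z\<in>N. measure lebesgue (box z (z + 1)))" by (simp add: cube)
    also have "\<dots> = measure lebesgue (\<Union>z\<in>N. box z (z + 1))"
    proof (rule measure_UNION'[symmetric, OF finN])
      show "pairwise (\<lambda>z z'. disjnt (box z (z + 1)) (box z' (z' + 1))) N"
      proof (rule pairwiseI)
        fix z z' assume z: "z \<in> N" "z' \<in> N" "z \<noteq> z'"
        have False if w: "w \<in> box z (z + 1)" "w \<in> box z' (z' + 1)" for w
        proof -
          have "z $ i = z' $ i" for i
          proof -
            have "z $ i \<in> \<int>" "z' $ i \<in> \<int>" using z by (auto simp: N_def int_lattice_def)
            moreover have "z $ i < w $ i" "w $ i < z $ i + 1" "z' $ i < w $ i" "w $ i < z' $ i + 1"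
              using w by (simp_all add: mem_box_cart)
            then have "\<bar>z $ i - z' $ i\<bar> < 1" by linarith
            ultimately show ?thesis by (metis Ints_diff Ints_nonzero_abs_less1 eq_iff_diff_eq_0)
          qed
          then show False using z(3) by (simp add: vec_eq_iff)
        qed
        then show "disjnt (box z (z + 1)) (box z' (z' + 1))" by (auto simp: disjnt_iff)
      qed
    qed auto
    also have "\<dots> \<le> measure lebesgue T"
    proof (rule measure_mono_fmeasurable)
      show "T \<in> lmeasurable"
        unfolding T_def using comp
        by (intro lmeasurable_compact compact_continuous_image continuous_intros)
      show "(\<Union>z\<in>N. box z (z + 1)) \<subseteq> T"
      proof
        fix w assume "w \<in> (\<Union>z\<in>N. box z (z + 1))"
        then obtain x where x: "x \<in> P" and w: "w \<in> box (real m *\<^sub>R x) (real m *\<^sub>R x + 1)"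
          by (auto simp: N_def)
        define u where "u = w - real m *\<^sub>R x"
        have "norm u \<le> (\<Sum>i\<in>UNIV. \<bar>u $ i\<bar>)" by (rule norm_le_l1_cart)
        also have "\<dots> \<le> (\<Sum>i\<in>(UNIV :: 'n set). 1)"
        proof (rule sum_mono)
          fix i
          have "real m * x $ i < w $ i" "w $ i < real m * x $ i + 1"
            using w by (simp_all add: mem_box_cart)
          then show "\<bar>u $ i\<bar> \<le> 1" by (simp add: u_def abs_le_iff)
        qed
        finally have "norm u \<le> r * e" using e(1) by (simp add: r_def)
        then have "norm ((1 / r) *\<^sub>R u) \<le> e" using r by (simp add: field_simps)
        then have y: "p + (1 / r) *\<^sub>R u \<in> P" using e(2) by (auto simp: dist_norm)
        \<comment> \<open>The weights are chosen so that m x + u + r p is (m + r) times a convex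
          combination of the points x and p + u/r of \<open>P\<close>.\<close>
        define t where "t = r / (real m + r)"
        have t: "0 \<le> t" "t \<le> 1" "(real m + r) * t = r" "(real m + r) * (1 - t) = real m"
          using r by (auto simp: t_def field_simps)
        have "(1 - t) *\<^sub>R x + t *\<^sub>R (p + (1 / r) *\<^sub>R u) \<in> P"
          by (rule convexD[OF conv x y]) (use t in auto)
        moreover have "(real m + r) *\<^sub>R ((1 - t) *\<^sub>R x + t *\<^sub>R (p + (1 / r) *\<^sub>R u)) + - (r *\<^sub>R p)
            = real m *\<^sub>R x + u"
          unfolding scaleR_add_right[of "real m + r"] scaleR_scaleR t(3,4) using r
          by (simp add: scaleR_add_right)
        moreover have "real m *\<^sub>R x + u = w" by (simp add: u_def)
        ultimately show "w \<in> T" unfolding T_def by (metis (no_types, lifting) image_eqI)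
      qed
      show "(\<Union>z\<in>N. box z (z + 1)) \<in> sets lebesgue"
        by (intro sets.finite_UN finN) auto
    qed
    also have "\<dots> = (real m + r) ^ CARD('n) * measure lebesgue P"
      unfolding T_def measure_lebesgue_affine using r by simp
    finally show "real (card ((\<lambda>x. real m *\<^sub>R x) ` P \<inter> int_lattice))
      \<le> (real m + r) ^ CARD('n) * measure lebesgue P" by (simp add: N_def)
  qed
qed

end

section \<open>The leading coefficient: volume above, roots below\<close>

lemma lead_coeff_le_of_growth:
  fixes R :: "real poly"
  assumes "\<And>m. \<bar>poly R (real m)\<bar> \<le> (real m + r) ^ degree R * V"
  shows "\<bar>lead_coeff R\<bar> \<le> V"
\<comment> \<open>After division by m^d the shift by \<open>r\<close> disappears in the
  limit.\<close>
proof (rule tendsto_le)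
  let ?d = "degree R"
  have "filterlim (\<lambda>m. real m) at_infinity sequentially"
    using filterlim_real_sequentially at_top_le_at_infinity filterlim_mono by blast
  then show "(\<lambda>m. \<bar>poly R (real m) / real m ^ ?d\<bar>) \<longlonglongrightarrow> \<bar>lead_coeff R\<bar>"
    by (intro tendsto_rabs filterlim_compose[OF poly_divide_tendsto_aux])
  have "(\<lambda>m. (1 + r / real m) ^ ?d * V) \<longlonglongrightarrow> (1 + 0) ^ ?d * V"
    by (intro tendsto_intros lim_const_over_n)
  then show "(\<lambda>m. (1 + r / real m) ^ ?d * V) \<longlonglongrightarrow> V" by simp
  show "\<forall>\<^sub>F m in sequentially. \<bar>poly R (real m) / real m ^ ?d\<bar> \<le> (1 + r / real m) ^ ?d * V"
    using eventually_gt_at_top[of 0]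
  proof eventually_elim
    case (elim m)
    have "\<bar>poly R (real m) / real m ^ ?d\<bar> \<le> (real m + r) ^ ?d * V / real m ^ ?d"
      using assms[of m] elim by (simp add: abs_divide divide_right_mono)
    also have "1 + r / real m = (real m + r) / real m" using elim by (simp add: field_simps)
    then have "(real m + r) ^ ?d * V / real m ^ ?d = (1 + r / real m) ^ ?d * V"
      by (simp add: power_divide)
    finally show ?case .
  qed
qed simp

text \<open>Uniqueness for the definite description: the difference of two candidates vanishes at
  all naturals, hence is zero.\<close>

lemma ehrhart_poly_eqI:
  fixes P :: "(real ^ 'n) set"
  assumes "degree L = CARD('n)"
    and "\<And>m. poly L (of_nat m) = of_nat (card ((\<lambda>x. real m *\<^sub>R x) ` P \<inter> int_lattice))"
  shows "ehrhart_poly P = L"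
  unfolding ehrhart_poly_def
proof (rule the_equality)
  fix L' :: "complex poly"
  assume L': "degree L' = CARD('n) \<and> (\<forall>m. poly L' (of_nat m) =
    of_nat (card ((\<lambda>x. real m *\<^sub>R x) ` P \<inter> int_lattice)))"
  have "range of_nat \<subseteq> {z. poly (L' - L) z = 0}" using L' assms(2) by auto
  moreover have "infinite (range (of_nat :: nat \<Rightarrow> complex))"
    by (intro range_inj_infinite inj_of_nat)
  ultimately have "infinite {z. poly (L' - L) z = 0}" using finite_subset by blast
  then have "L' - L = 0" using poly_roots_finite by blast
  then show "L' = L" by simp
qed (use assms in auto)

text \<open>Separately, the distances from a root to 0 and to -1 are only bounded by 1. Paired at
  the same root they are two positive numbers with sum 1, because the root is real.\<close>

lemma lead_coeff_ge_of_roots: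
  fixes p :: "complex poly"
  assumes roots: "\<And>z. poly p z = 0 \<Longrightarrow> Im z = 0 \<and> -1 < Re z \<and> Re z < 0"
    and "1 \<le> norm (poly p 0)" "1 \<le> norm (poly p (-1))"
  shows "2 ^ degree p \<le> norm (lead_coeff p)"
proof -
  let ?a = "lead_coeff p" and ?d = "degree p"
  obtain root where root: "smult ?a (\<Prod>i<?d. [:-root i, 1:]) = p"
    by (rule complex_poly_decompose')
  have p: "poly p z = ?a * (\<Prod>i<?d. z - root i)" for z
    by (subst root[symmetric]) (simp add: poly_prod)
  have quarter: "norm (0 - root i) * norm (-1 - root i) \<le> 1 / 4" if "i < ?d" for i
  proof -
    have "poly p (root i) = 0" unfolding p using that by (auto intro!: prod_zero)
    then have z: "Im (root i) = 0" "-1 < Re (root i)" "Re (root i) < 0" using roots by auto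
    define x where "x = Re (root i)"
    have "root i = of_real x" using z(1) by (simp add: x_def complex_eq_iff)
    then have "0 - root i = of_real (- x)" "-1 - root i = of_real (-1 - x)" by simp_all
    then have "norm (0 - root i) * norm (-1 - root i) = \<bar>- x\<bar> * \<bar>-1 - x\<bar>"
      by (simp only: norm_of_real)
    \<comment> \<open>The signs give -x(1 + x); completing the square shows the maximum 1/4, at x =
      -1/2.\<close>
    also have "\<dots> = 1 / 4 - (x + 1 / 2)\<^sup>2"
      using z by (simp add: x_def power2_eq_square algebra_simps)
    finally show ?thesis by simp
  qed
  have "1 \<le> norm (poly p 0) * norm (poly p (-1))"
    using mult_mono[OF assms(2,3)] by simp
  also have "\<dots> = (norm ?a)\<^sup>2 * (\<Prod>i<?d. norm (0 - root i) * norm (-1 - root i))"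
    unfolding p by (simp add: norm_mult power2_eq_square prod.distrib flip: prod_norm)
  also have "\<dots> \<le> (norm ?a)\<^sup>2 * (\<Prod>i<?d. 1 / 4)"
    using quarter by (intro mult_left_mono prod_mono) auto
  also have "(\<Prod>i<?d. 1 / 4 :: real) = 1 / (2 ^ ?d)\<^sup>2"
  proof -
    have "(2 ^ ?d)\<^sup>2 = (4 :: real) ^ ?d"
      by (simp add: power2_eq_square flip: power_mult_distrib)
    then show ?thesis by (simp add: power_one_over)
  qed
  finally have "(2 ^ ?d)\<^sup>2 \<le> (norm ?a)\<^sup>2" by (simp add: field_simps)
  then show ?thesis by (rule power2_le_imp_le) simp
qed

theorem proposition1p8:
  fixes P :: "(real ^ 'n) set"
  assumes "reflexive_polytope P"
    and "real_polytope P"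
    and "\<And>z. poly (ehrhart_poly P) z = 0 \<Longrightarrow> -1 < Re z \<and> Re z < 0"
  shows "measure lebesgue P \<ge> 2 ^ CARD('n)"
proof -
  have P: "lattice_polytope P" using assms(1) by (simp add: reflexive_polytope_def)
  obtain R :: "real poly" where R: "degree R = CARD('n)" "poly R (-1) \<in> \<int>"
    "\<And>m. poly R (real m) = real (card ((\<lambda>x. real m *\<^sub>R x) ` P \<inter> int_lattice))"
    using ehrhart_theorem[OF P] by metis
  define p where "p = map_poly complex_of_real R"
  have poly_p: "poly p (complex_of_real x) = complex_of_real (poly R x)" for x
    unfolding p_def by (induction R) (auto simp: map_poly_pCons)
  have deg: "degree p = CARD('n)" and lead: "norm (lead_coeff p) = \<bar>lead_coeff R\<bar>"
    using R(1) by (simp_all add: p_def degree_map_poly coeff_map_poly)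
  have p: "ehrhart_poly P = p"
    using R(3) poly_p[of "real _"] by (intro ehrhart_poly_eqI deg) simp
  have roots: "Im z = 0 \<and> -1 < Re z \<and> Re z < 0" if "poly p z = 0" for z
    using assms(2,3) that p by (simp add: real_polytope_def)
  have one_le: "1 \<le> norm (poly p (complex_of_real x))" if "poly R x \<in> \<int>" "x = 0 \<or> x = -1" for x
  proof -
    have "poly R x \<noteq> 0"
    proof
      assume "poly R x = 0"
      then have "poly p (complex_of_real x) = 0" by (simp only: poly_p of_real_0)
      from roots[OF this] show False using that(2) by auto
    qed
    with that(1) have "1 \<le> \<bar>poly R x\<bar>" by (rule Ints_nonzero_abs_ge1)
    then show ?thesis by (simp only: poly_p norm_of_real)
  qed
  \<comment> \<open>The value at 0 is a cardinality, whereas the one at -1 is integral through the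
    binomials.\<close>
  have "poly R 0 \<in> \<int>" using R(3)[of 0] by simp
  then have "2 ^ degree p \<le> norm (lead_coeff p)"
    using one_le[of 0] one_le[of "-1"] R(2) by (intro lead_coeff_ge_of_roots roots) simp_all
  then have "2 ^ CARD('n) \<le> \<bar>lead_coeff R\<bar>"
    unfolding lead unfolding deg .
  also have "\<bar>lead_coeff R\<bar> \<le> measure lebesgue P"
  proof -
    obtain r where "0 < r" and r: "\<And>m. real (card ((\<lambda>x. real m *\<^sub>R x) ` P \<inter> int_lattice))
      \<le> (real m + r) ^ CARD('n) * measure lebesgue P"
      using card_dilate_le_volume[OF P] by metis
    show ?thesis
      by (rule lead_coeff_le_of_growth[of _ r]) (use r R in simp)
  qed
  finally show ?thesis .
qed

end
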